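(* Let $(E,(\cdot,\cdot),\mathcal H)$ be an extended affine Lie algebra with root system $R$ and core $E_c$, let $\tau$ be a finite order automorphism of the Lie algebra $E$, and fix $\epsilon\in\{1,-1\}$. (i) If $\tau(E_\alpha)=E_{\epsilon\alpha}$ for all $\alpha\in R^\times$, then - $\tau|_{\mathcal H\cap E_c}=\epsilon\,\mathrm{id}$; - if $\epsilon=-1$ then $\tau^2=\mathrm{id}$; - $\tau|_{\mathcal H}=\epsilon\,\mathrm{id}_{\mathcal H}$ modulo $Z(E_c)$, i.e. $\tau(h)-\epsilon h\in Z(E_c)$ for all $h\in\mathcal H$, where $Z(E_c)$ is the center of $E_c$. (ii) $\tau(E_\alpha)=E_{\epsilon\alpha}$ for all $\alpha\in R$ if and only if $\tau(h)=\epsilon h$ for all $h\in\mathcal H$. (iii) If $\tau(E_\alpha)=E_{\epsilon\alpha}$ for all $\alpha\in R$, then $\tau$ preserves the form $(\cdot,\cdot)$.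
   Context: All vector spaces are over $\mathbb C$. An extended affine Lie algebra is a triple $(E,(\cdot,\cdot),\mathcal H)$ where $E$ is a Lie algebra, $\mathcal H$ is a non-trivial finite dimensional subalgebra and $(\cdot,\cdot)$ is a symmetric bilinear form on $E$ such that: (A1) the form is invariant and non-degenerate; (A2) $E=\sum_{\alpha\in R}E_\alpha$ with $E_\alpha=\{x\in E\mid [h,x]=\alpha(h)x\ \forall h\in\mathcal H\}$, $R=\{\alpha\in\mathcal H^\star\mid E_\alpha\neq\{0\}\}$ and $E_0=\mathcal H$ ($R$ is the root system of $E$); the form restricted to $\mathcal H$ is then non-degenerate, $t_\alpha\in\mathcal H$ is defined by $\alpha(h)=(h,t_\alpha)$, and $(\alpha,\beta):=(t_\alpha,t_\beta)$ on $\mathcal H^\star$; $R^0=\{\alpha\in R\mid(\alpha,\alpha)=0\}$ (isotropic roots), $R^\times=R\setminus R^0$ (non-isotropic roots), and the core $E_c$ is the subalgebra generated by $E_\alpha$, $\alpha\in R^\times$; (A3) $\mathrm{ad}(x)$ is locally nilpotent for $x\in E_\alpha$, $\alpha\in R^\times$; (A4) (tameness) the centralizer of $E_c$ in $E$ is contained in $E_c$; (A5) the $\mathbb Z$-span of $R$ is a free abelian group of finite rank; (A6) if $R^\times=R_1\uplus R_2$ with $R_1,R_2$ non-empty then $R_1\not\perp R_2$. *)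

theory Defs
  imports Complex_Main "HOL-Library.Function_Algebras"
begin

text \<open>
  A Lie algebra \<open>E\<close> over the complex numbers lives on a whole type \<open>'e\<close>: addition comes from the
  class \<^class>\<open>ab_group_add\<close>, the scalar multiplication and the bracket are explicit operations.
\<close>

locale complex_lie_algebra = vector_space scale
  for scale :: "complex \<Rightarrow> 'e::ab_group_add \<Rightarrow> 'e" +
  fixes bracket :: "'e \<Rightarrow> 'e \<Rightarrow> 'e"
  assumes bracket_linear_left: "Vector_Spaces.linear scale scale (\<lambda>x. bracket x y)"
    and bracket_linear_right: "Vector_Spaces.linear scale scale (\<lambda>y. bracket x y)"
    and bracket_self: "bracket x x = 0"
    and jacobi: "bracket x (bracket y z) + bracket y (bracket z x) + bracket z (bracket x y) = 0"

definition lie_subalgebra ::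
    "(complex \<Rightarrow> 'e::ab_group_add \<Rightarrow> 'e) \<Rightarrow> ('e \<Rightarrow> 'e \<Rightarrow> 'e) \<Rightarrow> 'e set \<Rightarrow> bool" where
  "lie_subalgebra scale bracket S \<longleftrightarrow>
     module.subspace scale S \<and> (\<forall>x\<in>S. \<forall>y\<in>S. bracket x y \<in> S)"

definition lie_automorphism ::
    "(complex \<Rightarrow> 'e::ab_group_add \<Rightarrow> 'e) \<Rightarrow> ('e \<Rightarrow> 'e \<Rightarrow> 'e) \<Rightarrow> ('e \<Rightarrow> 'e) \<Rightarrow> bool" where
  "lie_automorphism scale bracket \<tau> \<longleftrightarrow>
     Vector_Spaces.linear scale scale \<tau> \<and> bij \<tau> \<and>
     (\<forall>x y. \<tau> (bracket x y) = bracket (\<tau> x) (\<tau> y))"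

definition centralizer :: "('e \<Rightarrow> 'e \<Rightarrow> 'e::zero) \<Rightarrow> 'e set \<Rightarrow> 'e set" where
  "centralizer bracket S = {x. \<forall>y\<in>S. bracket x y = 0}"

definition center :: "('e \<Rightarrow> 'e \<Rightarrow> 'e::zero) \<Rightarrow> 'e set \<Rightarrow> 'e set" where
  "center bracket S = S \<inter> centralizer bracket S"

text \<open>
  The dual space of a subspace \<open>H\<close>: a functional on \<open>H\<close> is represented by its extension by \<open>0\<close>
  outside \<open>H\<close>, so that functionals on \<open>H\<close> are equal iff the representing functions are, and the
  vector space operations on the dual are pointwise.
\<close>

definition dual_space :: "(complex \<Rightarrow> 'e::ab_group_add \<Rightarrow> 'e) \<Rightarrow> 'e set \<Rightarrow> ('e \<Rightarrow> complex) set" where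
  "dual_space scale H =
     {\<alpha>. (\<forall>x\<in>H. \<forall>y\<in>H. \<alpha> (x + y) = \<alpha> x + \<alpha> y) \<and>
         (\<forall>c. \<forall>x\<in>H. \<alpha> (scale c x) = c * \<alpha> x) \<and>
         (\<forall>x. x \<notin> H \<longrightarrow> \<alpha> x = 0)}"

definition root_space ::
    "(complex \<Rightarrow> 'e \<Rightarrow> 'e) \<Rightarrow> ('e \<Rightarrow> 'e \<Rightarrow> 'e) \<Rightarrow> 'e set \<Rightarrow> ('e \<Rightarrow> complex) \<Rightarrow> 'e set" where
  "root_space scale bracket H \<alpha> = {x. \<forall>h\<in>H. bracket h x = scale (\<alpha> h) x}"

definition roots ::
    "(complex \<Rightarrow> 'e::ab_group_add \<Rightarrow> 'e) \<Rightarrow> ('e \<Rightarrow> 'e \<Rightarrow> 'e) \<Rightarrow> 'e set \<Rightarrow> ('e \<Rightarrow> complex) set" where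
  "roots scale bracket H = {\<alpha> \<in> dual_space scale H. root_space scale bracket H \<alpha> \<noteq> {0}}"

text \<open>
  The element \<open>t\<^sub>\<alpha>\<close> of \<open>H\<close> and the induced form on the dual of \<open>H\<close>. The description is proper
  whenever the form restricted to the finite dimensional \<open>H\<close> is non-degenerate, which follows from
  \<open>form_invariant\<close>, \<open>form_nondegenerate\<close>, \<open>root_space_decomposition\<close> and \<open>root_space_zero\<close>
  in the locale below.
\<close>

definition dual_vector ::
    "('e \<Rightarrow> 'e \<Rightarrow> complex) \<Rightarrow> 'e set \<Rightarrow> ('e \<Rightarrow> complex) \<Rightarrow> 'e" where
  "dual_vector form H \<alpha> = (THE t. t \<in> H \<and> (\<forall>h\<in>H. \<alpha> h = form h t))"

definition dual_form ::
    "('e \<Rightarrow> 'e \<Rightarrow> complex) \<Rightarrow> 'e set \<Rightarrow> ('e \<Rightarrow> complex) \<Rightarrow> ('e \<Rightarrow> complex) \<Rightarrow> complex" where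
  "dual_form form H \<alpha> \<beta> = form (dual_vector form H \<alpha>) (dual_vector form H \<beta>)"

definition isotropic_roots ::
    "(complex \<Rightarrow> 'e::ab_group_add \<Rightarrow> 'e) \<Rightarrow> ('e \<Rightarrow> 'e \<Rightarrow> 'e) \<Rightarrow> ('e \<Rightarrow> 'e \<Rightarrow> complex) \<Rightarrow> 'e set
      \<Rightarrow> ('e \<Rightarrow> complex) set" where
  "isotropic_roots scale bracket form H =
     {\<alpha> \<in> roots scale bracket H. dual_form form H \<alpha> \<alpha> = 0}"

definition nonisotropic_roots ::
    "(complex \<Rightarrow> 'e::ab_group_add \<Rightarrow> 'e) \<Rightarrow> ('e \<Rightarrow> 'e \<Rightarrow> 'e) \<Rightarrow> ('e \<Rightarrow> 'e \<Rightarrow> complex) \<Rightarrow> 'e set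
      \<Rightarrow> ('e \<Rightarrow> complex) set" where
  "nonisotropic_roots scale bracket form H =
     roots scale bracket H - isotropic_roots scale bracket form H"

definition core ::
    "(complex \<Rightarrow> 'e::ab_group_add \<Rightarrow> 'e) \<Rightarrow> ('e \<Rightarrow> 'e \<Rightarrow> 'e) \<Rightarrow> ('e \<Rightarrow> 'e \<Rightarrow> complex) \<Rightarrow> 'e set
      \<Rightarrow> 'e set" where
  "core scale bracket form H =
     lie_subalgebra scale bracket hull
       (\<Union>\<alpha>\<in>nonisotropic_roots scale bracket form H. root_space scale bracket H \<alpha>)"

definition int_scale :: "int \<Rightarrow> ('e \<Rightarrow> complex) \<Rightarrow> 'e \<Rightarrow> complex" where
  "int_scale n \<alpha> = (\<lambda>h. of_int n * \<alpha> h)"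

lemma module_int_scale: "module int_scale"
  by unfold_locales (auto simp: int_scale_def fun_eq_iff algebra_simps)

locale extended_affine_lie_algebra = complex_lie_algebra scale bracket
  for scale :: "complex \<Rightarrow> 'e::ab_group_add \<Rightarrow> 'e" and bracket :: "'e \<Rightarrow> 'e \<Rightarrow> 'e" +
  fixes form :: "'e \<Rightarrow> 'e \<Rightarrow> complex" and H :: "'e set"
  assumes H_subalgebra: "lie_subalgebra scale bracket H"
    and H_nontrivial: "H \<noteq> {0}"
    and H_finite_dim: "\<exists>B. finite B \<and> span B = H"
    and form_linear_left: "Vector_Spaces.linear scale (*) (\<lambda>x. form x y)"
    and form_linear_right: "Vector_Spaces.linear scale (*) (\<lambda>y. form x y)"
    and form_symmetric: "form x y = form y x"
    and form_invariant: "form (bracket x y) z = form x (bracket y z)"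
    and form_nondegenerate: "(\<And>y. form x y = 0) \<Longrightarrow> x = 0"
    and root_space_decomposition:
      "span (\<Union>\<alpha>\<in>roots scale bracket H. root_space scale bracket H \<alpha>) = UNIV"
    and root_space_zero: "root_space scale bracket H (\<lambda>h. 0) = H"
    and ad_locally_nilpotent:
      "\<alpha> \<in> nonisotropic_roots scale bracket form H \<Longrightarrow> x \<in> root_space scale bracket H \<alpha> \<Longrightarrow>
        \<exists>n. (bracket x ^^ n) y = 0"
    and tame:
      "centralizer bracket (core scale bracket form H) \<subseteq> core scale bracket form H"
    and root_lattice_free_finite_rank:
      "\<exists>B. finite B \<and> \<not> module.dependent int_scale B \<and>
           module.span int_scale B = module.span int_scale (roots scale bracket H)"
    and nonisotropic_roots_indecomposable:
      "nonisotropic_roots scale bracket form H = R1 \<union> R2 \<Longrightarrow> R1 \<inter> R2 = {} \<Longrightarrow>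
        R1 \<noteq> {} \<Longrightarrow> R2 \<noteq> {} \<Longrightarrow> \<exists>\<alpha>\<in>R1. \<exists>\<beta>\<in>R2. dual_form form H \<alpha> \<beta> \<noteq> 0"

end

theory Submission
  imports Defs
begin

text \<open>
  Let \<open>t \<alpha>\<close> represent the root \<open>\<alpha>\<close> on \<open>H\<close>, so that \<open>bracket x y = scale (form x y) (t \<alpha>)\<close> for opposite
  root vectors \<open>x\<close>, \<open>y\<close>. Suppose that \<open>\<tau>\<close> maps the root spaces of \<open>\<alpha>\<close> and \<open>- \<alpha>\<close> to those of
  \<open>\<epsilon> * \<alpha>\<close> and \<open>- \<epsilon> * \<alpha>\<close>. Then \<open>\<tau> (t \<alpha>)\<close> is a multiple of \<open>t \<alpha>\<close>, and for non-isotropic \<open>\<alpha>\<close> the relation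
  \<open>bracket (t \<alpha>) x = scale (\<phi> \<alpha> \<alpha>) x\<close>, with \<open>\<phi>\<close> the form on the dual of \<open>H\<close>,
  leaves only the factor \<open>\<epsilon>\<close> (\<open>tau_dual_vector\<close>). The
  intersection of \<open>H\<close> with the core is spanned by these \<open>t \<alpha>\<close> (\<open>H_core_span\<close>), so \<open>\<tau>\<close> is \<open>\<epsilon>\<close> there. For
  any \<open>h\<close> in \<open>H\<close> the element \<open>\<tau> h - scale \<epsilon> h\<close> kills the generators of the core, so by tameness it is in
  the center of the core.

  Finite order enters through one observation (\<open>no_displacement\<close>): if \<open>\<tau> \<circ> \<tau>\<close> moves \<open>x\<close> by a vector \<open>z\<close>
  that it fixes, then \<open>z = 0\<close>. For \<open>\<epsilon> = - 1\<close>, one-dimensionality of the non-isotropic root spaces shows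
  that \<open>\<tau> \<circ> \<tau>\<close> is the identity on the core. The core is an ideal, so \<open>\<tau> (\<tau> x) - x\<close> centralizes it, hence lies
  in it and is fixed by \<open>\<tau> \<circ> \<tau>\<close>; therefore it vanishes. If \<open>\<tau>\<close> permutes all root spaces by the sign, the
  same observation applies to \<open>h\<close> in \<open>H\<close>, because \<open>\<tau> h - scale \<epsilon> h\<close> now lies in \<open>H\<close> as well as in the
  core. Once \<open>\<tau>\<close> is \<open>\<epsilon>\<close> on \<open>H\<close>, applying it to \<open>bracket x y\<close> shows that it preserves the form.

  Two structural facts are needed: non-isotropic root spaces are lines
  (\<open>nonisotropic_root_space_line\<close>), and the core is an ideal (\<open>core_ideal\<close>), which rests on the
  orthogonality of isotropic to non-isotropic roots (\<open>isotropic_orthogonal_nonisotropic\<close>). Both come from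
  one computation with opposite root vectors (\<open>ladder\<close>), read once in a three-dimensional simple Lie
  algebra and once in a Heisenberg algebra.
\<close>

section \<open>Lie algebras: ladders and generated subalgebras\<close>

context complex_lie_algebra
begin

lemma bracket_add_left: "bracket (x + y) z = bracket x z + bracket y z"
  and bracket_scale_left: "bracket (scale c x) z = scale c (bracket x z)"
  using bracket_linear_left[of z] by (auto simp: Vector_Spaces.linear_iff)

lemma bracket_add_right: "bracket z (x + y) = bracket z x + bracket z y"
  and bracket_scale_right: "bracket z (scale c x) = scale c (bracket z x)"
  using bracket_linear_right[of z] by (auto simp: Vector_Spaces.linear_iff)

lemma bracket_zero_left [simp]: "bracket 0 z = 0"
  and bracket_zero_right [simp]: "bracket z 0 = 0"
  using bracket_scale_left[of 0 0 z] bracket_scale_right[of z 0 0] by auto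

lemma bracket_minus_left: "bracket (- x) z = - bracket x z"
  and bracket_minus_right: "bracket z (- x) = - bracket z x"
  using bracket_scale_left[of "-1" x z] bracket_scale_right[of z "-1" x] by auto

lemma bracket_diff_left: "bracket (x - y) z = bracket x z - bracket y z"
  using bracket_add_left[of x "- y" z] by (simp add: bracket_minus_left)

lemma bracket_skew: "bracket y x = - bracket x y"
proof -
  have "bracket (x + y) (x + y) = bracket x y + bracket y x"
    by (simp add: bracket_add_left bracket_add_right bracket_self[of x] bracket_self[of y])
  then have "bracket x y + bracket y x = 0"
    by (simp add: bracket_self)
  then show ?thesis
    by (simp add: eq_neg_iff_add_eq_0 add.commute)
qed

lemma bracket_derivation:
  "bracket x (bracket y z) = bracket (bracket x y) z + bracket y (bracket x z)"
proof -
  have "bracket x (bracket y z) = - (bracket y (bracket z x) + bracket z (bracket x y))"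
    using jacobi[of x y z] by (metis add.assoc eq_neg_iff_add_eq_0)
  also have "\<dots> = bracket (bracket x y) z + bracket y (bracket x z)"
    using bracket_skew[of x z] bracket_skew[of "bracket x y" z]
    by (simp add: bracket_minus_right)
  finally show ?thesis .
qed

text \<open>
  The parameter \<open>\<kappa>\<close> lets one computation serve two subalgebras spanned by \<open>e\<close>, \<open>f\<close> and
  \<open>t = bracket e f\<close>: for \<open>\<kappa> \<noteq> 0\<close> it is, up to rescaling, the three-dimensional simple Lie algebra,
  and for \<open>\<kappa> = 0\<close> it is a Heisenberg algebra with central element \<open>t\<close>. The coefficient is the sum
  of the weights \<open>\<mu> - 2 * i * \<kappa>\<close> over \<open>i = 0..n\<close>.
\<close>

lemma ladder:
  assumes ef: "bracket e f = t" and tf: "bracket t f = scale (- 2 * \<kappa>) f"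
    and ey: "bracket e y = 0" and ty: "bracket t y = scale \<mu> y"
  shows "bracket e ((bracket f ^^ Suc n) y) =
    scale (of_nat (Suc n) * (\<mu> - of_nat n * \<kappa>)) ((bracket f ^^ n) y)"
proof -
  have weight: "bracket t ((bracket f ^^ n) y) = scale (\<mu> - 2 * of_nat n * \<kappa>) ((bracket f ^^ n) y)" for n
  proof (induction n)
    case 0
    then show ?case using ty by simp
  next
    case (Suc n)
    have "bracket t (bracket f ((bracket f ^^ n) y)) =
        scale (- 2 * \<kappa>) (bracket f ((bracket f ^^ n) y)) +
        scale (\<mu> - 2 * of_nat n * \<kappa>) (bracket f ((bracket f ^^ n) y))"
      by (simp add: bracket_derivation[of t f] tf Suc.IH bracket_scale_left bracket_scale_right
          bracket_minus_left)
    also have "\<dots> = scale (\<mu> - 2 * of_nat (Suc n) * \<kappa>) (bracket f ((bracket f ^^ n) y))"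
      by (simp add: algebra_simps flip: scale_left_distrib)
    finally show ?case by simp
  qed
  show ?thesis
  proof (induction n)
    case 0
    then show ?case
      using bracket_derivation[of e f y] by (simp add: ef ey ty)
  next
    case (Suc n)
    have "bracket e (bracket f ((bracket f ^^ Suc n) y)) =
        scale (\<mu> - 2 * of_nat (Suc n) * \<kappa>) ((bracket f ^^ Suc n) y) +
        scale (of_nat (Suc n) * (\<mu> - of_nat n * \<kappa>)) ((bracket f ^^ Suc n) y)"
      using bracket_derivation[of e f "(bracket f ^^ Suc n) y"] weight[of "Suc n"] Suc.IH
      by (simp add: ef bracket_scale_right)
    also have "\<dots> = scale (of_nat (Suc (Suc n)) * (\<mu> - of_nat (Suc n) * \<kappa>)) ((bracket f ^^ Suc n) y)"
      by (simp add: algebra_simps flip: scale_left_distrib)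
    finally show ?case by simp
  qed
qed

lemma last_nonzero_iterate:
  assumes "y \<noteq> 0" and "(bracket f ^^ N) y = 0"
  obtains n where "n < N" and "(bracket f ^^ n) y \<noteq> 0" and "bracket f ((bracket f ^^ n) y) = 0"
proof -
  let ?k = "LEAST k. (bracket f ^^ k) y = 0"
  have k: "(bracket f ^^ ?k) y = 0" and le: "?k \<le> N"
    using assms(2) by (auto intro: LeastI Least_le)
  with assms(1) obtain n where n: "?k = Suc n"
    by (cases ?k) auto
  have "(bracket f ^^ n) y \<noteq> 0"
    using not_less_Least[of n "\<lambda>k. (bracket f ^^ k) y = 0"] n by simp
  with k le n that[of n] show thesis by simp
qed

text \<open>
  At the last non-zero \<open>(bracket f ^^ n) y\<close> the coefficient in the ladder formula has to vanish.
\<close>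

lemma ladder_terminates:
  assumes ef: "bracket e f = t" and tf: "bracket t f = scale (- 2 * \<kappa>) f"
    and ey: "bracket e y = 0" and ty: "bracket t y = scale \<mu> y"
    and "y \<noteq> 0" and "(bracket f ^^ N) y = 0"
  shows "\<exists>n::nat. \<mu> = of_nat n * \<kappa>"
proof -
  obtain n where n: "(bracket f ^^ n) y \<noteq> 0" "bracket f ((bracket f ^^ n) y) = 0"
    using last_nonzero_iterate[OF assms(5,6)] by metis
  have "scale (of_nat (Suc n) * (\<mu> - of_nat n * \<kappa>)) ((bracket f ^^ n) y) = 0"
    using ladder[OF ef tf ey ty, of n] n(2) by simp
  with n(1) have "of_nat (Suc n) * (\<mu> - of_nat n * \<kappa>) = 0"
    by (metis scale_eq_0_iff)
  then have "\<mu> = of_nat n * \<kappa>"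
    by (metis mult_eq_0_iff of_nat_eq_0_iff nat.distinct(1) eq_iff_diff_eq_0)
  then show ?thesis by blast
qed

lemma lie_subalgebra_hull: "lie_subalgebra scale bracket (lie_subalgebra scale bracket hull S)"
  by (rule hull_in) (auto simp: lie_subalgebra_def intro: subspace_Inter)

text \<open>
  It is not enough that \<open>V\<close> contains the generators, because \<open>V\<close> need not be a subalgebra. But the
  elements of \<open>V\<close> that normalize \<open>V\<close> form one.
\<close>

lemma hull_subset_invariant_subspace:
  assumes V: "subspace V" and S: "S \<subseteq> V"
    and inv: "\<And>x v. x \<in> S \<Longrightarrow> v \<in> V \<Longrightarrow> bracket x v \<in> V"
  shows "lie_subalgebra scale bracket hull S \<subseteq> V"
proof -
  let ?N = "{x \<in> V. \<forall>v\<in>V. bracket x v \<in> V}"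
  have "subspace ?N"
    using V by (auto simp: subspace_def bracket_add_left bracket_scale_left)
  moreover have "bracket x y \<in> ?N" if "x \<in> ?N" "y \<in> ?N" for x y
  proof -
    have "bracket (bracket x y) v \<in> V" if "v \<in> V" for v
    proof -
      have "bracket (bracket x y) v = bracket x (bracket y v) - bracket y (bracket x v)"
        using bracket_derivation[of x y v] by simp
      with \<open>x \<in> ?N\<close> \<open>y \<in> ?N\<close> that V show ?thesis by (simp add: subspace_diff)
    qed
    with that show ?thesis by auto
  qed
  ultimately have "lie_subalgebra scale bracket ?N"
    by (auto simp: lie_subalgebra_def)
  with S inv have "lie_subalgebra scale bracket hull S \<subseteq> ?N"
    by (intro hull_minimal) auto
  then show ?thesis by auto
qed

lemma lie_subalgebra_centralizer_element: "lie_subalgebra scale bracket {y. bracket x y = 0}"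
  by (auto simp: lie_subalgebra_def subspace_def bracket_add_right bracket_scale_right
      bracket_derivation[of x])

lemma centralizer_hull:
  "centralizer bracket (lie_subalgebra scale bracket hull S) = centralizer bracket S"
proof
  show "centralizer bracket (lie_subalgebra scale bracket hull S) \<subseteq> centralizer bracket S"
    by (auto simp: centralizer_def hull_inc)
  show "centralizer bracket S \<subseteq> centralizer bracket (lie_subalgebra scale bracket hull S)"
  proof
    fix x assume "x \<in> centralizer bracket S"
    then have "S \<subseteq> {y. bracket x y = 0}"
      by (auto simp: centralizer_def)
    then have "lie_subalgebra scale bracket hull S \<subseteq> {y. bracket x y = 0}"
      by (intro hull_minimal lie_subalgebra_centralizer_element)
    then show "x \<in> centralizer bracket (lie_subalgebra scale bracket hull S)"
      by (auto simp: centralizer_def)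
  qed
qed

end

section \<open>Root spaces and the form\<close>

context extended_affine_lie_algebra
begin

abbreviation R :: "('e \<Rightarrow> complex) set" where "R \<equiv> roots scale bracket H"
abbreviation R' :: "('e \<Rightarrow> complex) set" where "R' \<equiv> nonisotropic_roots scale bracket form H"
abbreviation E :: "('e \<Rightarrow> complex) \<Rightarrow> 'e set" where "E \<equiv> root_space scale bracket H"
abbreviation t :: "('e \<Rightarrow> complex) \<Rightarrow> 'e" where "t \<equiv> dual_vector form H"
abbreviation \<phi> :: "('e \<Rightarrow> complex) \<Rightarrow> ('e \<Rightarrow> complex) \<Rightarrow> complex" where "\<phi> \<equiv> dual_form form H"
abbreviation Core :: "'e set" where "Core \<equiv> core scale bracket form H"

lemma form_add_left: "form (x + y) z = form x z + form y z"
  and form_scale_left: "form (scale c x) z = c * form x z"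
  using form_linear_left[of z] by (auto simp: Vector_Spaces.linear_iff)

lemma form_add_right: "form z (x + y) = form z x + form z y"
  and form_scale_right: "form z (scale c x) = c * form z x"
  using form_linear_right[of z] by (auto simp: Vector_Spaces.linear_iff)

lemma form_zero_left [simp]: "form 0 z = 0"
  and form_zero_right [simp]: "form z 0 = 0"
  using form_scale_left[of 0 0 z] form_scale_right[of z 0 0] by auto

lemma form_diff_right: "form z (x - y) = form z x - form z y"
  using form_add_right[of z "x - y" y] by simp

lemma subspace_H: "subspace H"
  using H_subalgebra by (simp add: lie_subalgebra_def)

lemma subspace_root_space: "subspace (E \<alpha>)"
  by (auto simp: subspace_def root_space_def bracket_add_right bracket_scale_right
      scale_right_distrib mult.commute)

lemma zero_in_root_space [simp]: "0 \<in> E \<alpha>"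
  by (rule subspace_0[OF subspace_root_space])

lemma root_space_cong: "(\<And>h. h \<in> H \<Longrightarrow> \<alpha> h = \<beta> h) \<Longrightarrow> E \<alpha> = E \<beta>"
  by (auto simp: root_space_def)

lemma root_space_eq_H: "(\<And>h. h \<in> H \<Longrightarrow> \<alpha> h = 0) \<Longrightarrow> E \<alpha> = H"
  using root_space_cong[of \<alpha> "\<lambda>h. 0"] root_space_zero by simp

lemma bracket_H_root_space: "h \<in> H \<Longrightarrow> x \<in> E \<alpha> \<Longrightarrow> bracket h x = scale (\<alpha> h) x"
  by (simp add: root_space_def)

lemma bracket_root_spaces:
  assumes "x \<in> E \<alpha>" "y \<in> E \<beta>" and "\<And>h. h \<in> H \<Longrightarrow> \<gamma> h = \<alpha> h + \<beta> h"
  shows "bracket x y \<in> E \<gamma>"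
  using assms
  by (auto simp: root_space_def bracket_derivation[of _ x y] bracket_scale_left bracket_scale_right
      scale_left_distrib)

lemma iterated_bracket_root_space:
  assumes "e \<in> E \<alpha>" "x \<in> E \<beta>"
  shows "(bracket e ^^ n) x \<in> E (\<lambda>h. \<beta> h + of_nat n * \<alpha> h)"
proof (induction n)
  case (Suc n)
  show ?case
    using bracket_root_spaces[OF assms(1) Suc.IH, of "\<lambda>h. \<beta> h + of_nat (Suc n) * \<alpha> h"]
    by (simp add: algebra_simps)
qed (use assms in simp)

lemma dual_space_add_mult:
  "\<alpha> \<in> dual_space scale H \<Longrightarrow> \<beta> \<in> dual_space scale H \<Longrightarrow> (\<lambda>h. \<alpha> h + c * \<beta> h) \<in> dual_space scale H"
  by (auto simp: dual_space_def algebra_simps)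

lemma roots_dual_space: "\<alpha> \<in> R \<Longrightarrow> \<alpha> \<in> dual_space scale H"
  by (simp add: roots_def)

lemma nonzero_root_vector:
  assumes "\<alpha> \<in> R"
  obtains x where "x \<in> E \<alpha>" "x \<noteq> 0"
  using assms zero_in_root_space[of \<alpha>] by (auto simp: roots_def)

lemma rootI: "\<alpha> \<in> dual_space scale H \<Longrightarrow> x \<in> E \<alpha> \<Longrightarrow> x \<noteq> 0 \<Longrightarrow> \<alpha> \<in> R"
  by (auto simp: roots_def)

lemma zero_root: "(\<lambda>h. 0) \<in> R"
  using H_nontrivial root_space_zero by (auto simp: roots_def dual_space_def)

lemma root_vector_induct [consumes 0, case_names root zero add scale]:
  assumes "\<And>\<alpha> x. \<alpha> \<in> R \<Longrightarrow> x \<in> E \<alpha> \<Longrightarrow> P x" and "P 0"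
    and "\<And>x y. P x \<Longrightarrow> P y \<Longrightarrow> P (x + y)" and "\<And>c x. P x \<Longrightarrow> P (scale c x)"
  shows "P x"
proof -
  have "x \<in> span (\<Union>\<alpha>\<in>R. E \<alpha>)"
    using root_space_decomposition by simp
  then show ?thesis
    by (rule span_induct) (use assms in \<open>auto simp: subspace_def\<close>)
qed

lemma form_root_spaces:
  assumes "x \<in> E \<alpha>" "y \<in> E \<beta>" "h \<in> H" "\<alpha> h + \<beta> h \<noteq> 0"
  shows "form x y = 0"
proof -
  have "form (bracket x h) y = form x (bracket h y)"
    by (rule form_invariant)
  then have "- \<alpha> h * form x y = \<beta> h * form x y"
    using assms(1-3) bracket_skew[of x h]
    by (simp add: bracket_H_root_space form_scale_left form_scale_right flip: scale_minus_left)
  then have "(\<alpha> h + \<beta> h) * form x y = 0"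
    by (auto simp: distrib_right add_eq_0_iff)
  with assms(4) show ?thesis by simp
qed

text \<open>
  A root space is orthogonal to every other one except that of the opposite root, so
  non-degeneracy of the form has to be witnessed there.
\<close>

lemma opposite_root_vector:
  assumes \<alpha>: "\<alpha> \<in> R" and x: "x \<in> E \<alpha>" "x \<noteq> 0"
  obtains y where "y \<in> E (\<lambda>h. - \<alpha> h)" "form x y = 1"
proof -
  obtain \<beta> z where z: "\<beta> \<in> R" "z \<in> E \<beta>" "form x z \<noteq> 0"
  proof (rule ccontr)
    assume "\<not> thesis"
    with that have vanish: "\<And>\<beta> z. \<beta> \<in> R \<Longrightarrow> z \<in> E \<beta> \<Longrightarrow> form x z = 0" by blast
    have "form x y = 0" for y
      by (induction y rule: root_vector_induct) (auto simp: vanish form_add_right form_scale_right)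
    with form_nondegenerate x(2) show False by blast
  qed
  then have "\<alpha> h + \<beta> h = 0" if "h \<in> H" for h
    using form_root_spaces[OF x(1) z(2) that] by blast
  then have "E \<beta> = E (\<lambda>h. - \<alpha> h)"
    by (intro root_space_cong) (simp add: eq_neg_iff_add_eq_0 add.commute)
  with z that[of "scale (1 / form x z) z"] show thesis
    by (simp add: form_scale_right subspace_scale[OF subspace_root_space])
qed

lemma H_eq_zeroI:
  assumes "h \<in> H" and "\<And>k. k \<in> H \<Longrightarrow> form k h = 0"
  shows "h = 0"
proof (rule ccontr)
  assume "h \<noteq> 0"
  then obtain k where "k \<in> E (\<lambda>h. 0)" "form h k = 1"
    using opposite_root_vector[OF zero_root, of h] assms(1) root_space_zero by auto
  with assms(2) root_space_zero form_symmetric[of h k] show False by auto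
qed

lemma dual_vector_unique:
  assumes "s \<in> H" "\<And>h. h \<in> H \<Longrightarrow> \<alpha> h = form h s"
  shows "t \<alpha> = s"
  unfolding dual_vector_def
proof (rule the_equality)
  show "s \<in> H \<and> (\<forall>h\<in>H. \<alpha> h = form h s)" using assms by simp
next
  fix u assume u: "u \<in> H \<and> (\<forall>h\<in>H. \<alpha> h = form h u)"
  with assms have "u - s = 0"
    by (intro H_eq_zeroI) (auto simp: form_diff_right subspace_diff[OF subspace_H])
  then show "u = s" by simp
qed

text \<open>
  Invariance of the form shows that the bracket of opposite root vectors represents a multiple of
  the root. This yields the existence of \<open>t \<alpha>\<close> without solving linear equations in \<open>H\<close>.
\<close>

lemma bracket_opposite_represents:
  assumes "x \<in> E \<alpha>" "y \<in> E (\<lambda>h. - \<alpha> h)"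
  shows "bracket x y \<in> H" and "h \<in> H \<Longrightarrow> form h (bracket x y) = \<alpha> h * form x y"
proof -
  show "bracket x y \<in> H"
    using bracket_root_spaces[OF assms, of "\<lambda>h. 0"] root_space_zero by simp
  show "form h (bracket x y) = \<alpha> h * form x y" if "h \<in> H"
    using form_invariant[of h x y] assms that by (simp add: bracket_H_root_space form_scale_left)
qed

lemma dual_vector:
  assumes "\<alpha> \<in> R"
  shows "t \<alpha> \<in> H" and "h \<in> H \<Longrightarrow> form h (t \<alpha>) = \<alpha> h"
proof -
  obtain x where x: "x \<in> E \<alpha>" "x \<noteq> 0" using nonzero_root_vector[OF assms] .
  obtain y where y: "y \<in> E (\<lambda>h. - \<alpha> h)" "form x y = 1" using opposite_root_vector[OF assms x] .
  have "t \<alpha> = bracket x y"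
    using bracket_opposite_represents[OF x(1) y(1)] y(2) by (intro dual_vector_unique) auto
  then show "t \<alpha> \<in> H" and "h \<in> H \<Longrightarrow> form h (t \<alpha>) = \<alpha> h"
    using bracket_opposite_represents[OF x(1) y(1)] y(2) by auto
qed

lemma bracket_opposite:
  assumes \<alpha>: "\<alpha> \<in> R" and xy: "x \<in> E \<alpha>" "y \<in> E (\<lambda>h. - \<alpha> h)"
  shows "bracket x y = scale (form x y) (t \<alpha>)"
proof -
  have "bracket x y - scale (form x y) (t \<alpha>) = 0"
    using bracket_opposite_represents[OF xy] dual_vector[OF \<alpha>]
    by (intro H_eq_zeroI) (auto simp: form_diff_right form_scale_right mult.commute
        intro: subspace_diff[OF subspace_H] subspace_scale[OF subspace_H])
  then show ?thesis by simp
qed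

lemma dual_form_eval: "\<alpha> \<in> R \<Longrightarrow> \<beta> \<in> R \<Longrightarrow> \<phi> \<alpha> \<beta> = \<alpha> (t \<beta>)"
  by (simp add: dual_form_def dual_vector form_symmetric[of "t \<alpha>"])

lemma dual_form_sym: "\<phi> \<alpha> \<beta> = \<phi> \<beta> \<alpha>"
  by (simp add: dual_form_def form_symmetric)

lemma dual_vector_add_mult:
  "\<alpha> \<in> R \<Longrightarrow> \<beta> \<in> R \<Longrightarrow> t (\<lambda>h. \<alpha> h + c * \<beta> h) = t \<alpha> + scale c (t \<beta>)"
  by (intro dual_vector_unique)
    (auto simp: dual_vector form_add_right form_scale_right
      intro!: subspace_add[OF subspace_H] subspace_scale[OF subspace_H])

lemma dual_form_add_mult_right:
  "\<alpha> \<in> R \<Longrightarrow> \<beta> \<in> R \<Longrightarrow> \<phi> \<gamma> (\<lambda>h. \<alpha> h + c * \<beta> h) = \<phi> \<gamma> \<alpha> + c * \<phi> \<gamma> \<beta>"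
  by (simp add: dual_form_def dual_vector_add_mult form_add_right form_scale_right)

lemma dual_form_add_mult_left:
  "\<alpha> \<in> R \<Longrightarrow> \<beta> \<in> R \<Longrightarrow> \<phi> (\<lambda>h. \<alpha> h + c * \<beta> h) \<gamma> = \<phi> \<alpha> \<gamma> + c * \<phi> \<beta> \<gamma>"
  using dual_form_add_mult_right[of \<alpha> \<beta> \<gamma> c] by (simp add: dual_form_sym)

lemma dual_vector_zero [simp]: "t (\<lambda>h. 0) = 0"
  by (rule dual_vector_unique) (auto simp: subspace_0[OF subspace_H])

lemma dual_vector_minus: "\<alpha> \<in> R \<Longrightarrow> t (\<lambda>h. - \<alpha> h) = - t \<alpha>"
  using dual_vector_add_mult[OF zero_root, of \<alpha> "-1"] by simp

lemma minus_root:
  assumes "\<alpha> \<in> R"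
  shows "(\<lambda>h. - \<alpha> h) \<in> R"
proof -
  obtain x where x: "x \<in> E \<alpha>" "x \<noteq> 0" using nonzero_root_vector[OF assms] .
  obtain y where y: "y \<in> E (\<lambda>h. - \<alpha> h)" "form x y = 1" using opposite_root_vector[OF assms x] .
  have "(\<lambda>h. - \<alpha> h) \<in> dual_space scale H"
    using dual_space_add_mult[OF roots_dual_space[OF zero_root] roots_dual_space[OF assms], of "-1"]
    by simp
  with y show ?thesis by (auto intro!: rootI[of _ y])
qed

lemma nonisotropic_iff: "\<alpha> \<in> R' \<longleftrightarrow> \<alpha> \<in> R \<and> \<phi> \<alpha> \<alpha> \<noteq> 0"
  by (auto simp: nonisotropic_roots_def isotropic_roots_def)

lemma minus_nonisotropic: "\<alpha> \<in> R' \<Longrightarrow> (\<lambda>h. - \<alpha> h) \<in> R'"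
  using form_scale_left[of "-1"] form_scale_right[of _ "-1"]
  by (simp add: nonisotropic_iff minus_root dual_form_def dual_vector_minus)

section \<open>Root strings and isotropic roots\<close>

text \<open>
  The opposite vectors \<open>e\<close>, \<open>f\<close> span with \<open>t \<alpha>\<close> a simple Lie algebra if \<open>\<alpha>\<close> is non-isotropic and a
  Heisenberg algebra if it is isotropic. In the isotropic case the conclusion says \<open>\<gamma> (t \<alpha>) = 0\<close>.
\<close>

lemma highest_weight:
  assumes \<alpha>: "\<alpha> \<in> R" and ef: "e \<in> E \<alpha>" "f \<in> E (\<lambda>h. - \<alpha> h)" "form e f = 1"
    and y: "y \<in> E \<gamma>" "y \<noteq> 0" "bracket e y = 0" and "(bracket f ^^ N) y = 0"
  shows "\<exists>n::nat. 2 * \<gamma> (t \<alpha>) = of_nat n * \<phi> \<alpha> \<alpha>"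
proof -
  have "\<exists>n::nat. \<gamma> (t \<alpha>) = of_nat n * (\<phi> \<alpha> \<alpha> / 2)"
  proof (rule ladder_terminates[of e f "t \<alpha>" _ y])
    show "bracket e f = t \<alpha>"
      using bracket_opposite[OF \<alpha> ef(1,2)] ef(3) by simp
    show "bracket (t \<alpha>) f = scale (- 2 * (\<phi> \<alpha> \<alpha> / 2)) f"
      using bracket_H_root_space[OF dual_vector(1)[OF \<alpha>] ef(2)] \<alpha> by (simp add: dual_form_eval)
    show "bracket (t \<alpha>) y = scale (\<gamma> (t \<alpha>)) y"
      using bracket_H_root_space[OF dual_vector(1)[OF \<alpha>] y(1)] .
  qed (use assms in auto)
  then show ?thesis by (auto simp: field_simps)
qed

text \<open>
  A vector \<open>y\<close> orthogonal to \<open>e\<close> in the opposite root space would be a highest weight vector of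
  negative weight \<open>-2\<close>. Hence root spaces of non-isotropic roots are lines.
\<close>

lemma nonisotropic_root_space_line:
  assumes \<alpha>: "\<alpha> \<in> R'" and ef: "e \<in> E \<alpha>" "f \<in> E (\<lambda>h. - \<alpha> h)" "form e f = 1"
    and z: "z \<in> E (\<lambda>h. - \<alpha> h)"
  shows "z = scale (form e z) f"
proof (rule ccontr)
  let ?y = "z - scale (form e z) f"
  assume "z \<noteq> scale (form e z) f"
  then have "?y \<noteq> 0" by simp
  moreover have y: "?y \<in> E (\<lambda>h. - \<alpha> h)"
    using z ef(2) by (intro subspace_diff subspace_scale subspace_root_space)
  moreover have "bracket e ?y = 0"
    using bracket_opposite[OF _ ef(1) y] \<alpha> ef(3)
    by (simp add: nonisotropic_iff form_diff_right form_scale_right)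
  moreover obtain N where "(bracket f ^^ N) ?y = 0"
    using ad_locally_nilpotent[OF minus_nonisotropic[OF \<alpha>] ef(2)] by blast
  ultimately obtain n :: nat where n: "2 * - \<alpha> (t \<alpha>) = of_nat n * \<phi> \<alpha> \<alpha>"
    using highest_weight[OF _ ef, of ?y "\<lambda>h. - \<alpha> h" N] \<alpha> by (auto simp: nonisotropic_iff)
  have "\<phi> \<alpha> \<alpha> = \<alpha> (t \<alpha>)"
    using \<alpha> by (simp add: nonisotropic_iff dual_form_eval)
  with n have "of_nat (n + 2) * \<phi> \<alpha> \<alpha> = 0"
    by (auto simp: distrib_right add_eq_0_iff)
  then have "of_nat (n + 2) = (0::complex)"
    using \<alpha> by (simp only: mult_eq_0_iff nonisotropic_iff simp_thms)
  then show False by (simp only: of_nat_eq_0_iff)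
qed

lemma cartan_integer:
  assumes \<alpha>: "\<alpha> \<in> R'" and \<delta>: "\<delta> \<in> R"
  obtains k :: int where "2 * \<phi> \<delta> \<alpha> = of_int k * \<phi> \<alpha> \<alpha>"
proof -
  have \<alpha>R: "\<alpha> \<in> R" using \<alpha> by (simp add: nonisotropic_iff)
  obtain e where e: "e \<in> E \<alpha>" "e \<noteq> 0" using nonzero_root_vector[OF \<alpha>R] .
  obtain f where f: "f \<in> E (\<lambda>h. - \<alpha> h)" "form e f = 1" using opposite_root_vector[OF \<alpha>R e] .
  obtain x where x: "x \<in> E \<delta>" "x \<noteq> 0" using nonzero_root_vector[OF \<delta>] .
  obtain M where "(bracket e ^^ M) x = 0"
    using ad_locally_nilpotent[OF \<alpha> e(1)] by blast
  then obtain m where m: "(bracket e ^^ m) x \<noteq> 0" "bracket e ((bracket e ^^ m) x) = 0"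
    using last_nonzero_iterate[OF x(2)] by metis
  obtain N where "(bracket f ^^ N) ((bracket e ^^ m) x) = 0"
    using ad_locally_nilpotent[OF minus_nonisotropic[OF \<alpha>] f(1)] by blast
  from highest_weight[OF \<alpha>R e(1) f iterated_bracket_root_space[OF e(1) x(1)] m this]
  obtain n :: nat where "2 * (\<delta> (t \<alpha>) + of_nat m * \<alpha> (t \<alpha>)) = of_nat n * \<phi> \<alpha> \<alpha>"
    by auto
  then have "2 * \<phi> \<delta> \<alpha> = of_int (int n - 2 * int m) * \<phi> \<alpha> \<alpha>"
    using \<alpha>R \<delta> by (simp add: dual_form_eval algebra_simps)
  then show thesis by (rule that)
qed

text \<open>
  Suppose that \<open>\<phi> \<alpha> \<delta> \<noteq> 0\<close>. The Heisenberg algebra of \<open>\<delta>\<close> acts on the sum of the root spaces of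
  \<open>\<alpha> + n * \<delta>\<close> with its central element acting as the non-zero scalar \<open>\<phi> \<alpha> \<delta>\<close>, so \<open>\<alpha> + n * \<delta>\<close> is
  a root for infinitely many \<open>n\<close>. But the norm of \<open>\<alpha> + n * \<delta>\<close> grows linearly with \<open>n\<close>, while its product
  with \<open>\<delta>\<close> is constant, so that the Cartan integers become smaller than \<open>1\<close> without vanishing.
\<close>

lemma isotropic_orthogonal_nonisotropic:
  assumes \<alpha>: "\<alpha> \<in> R'" and \<delta>: "\<delta> \<in> R" "\<phi> \<delta> \<delta> = 0"
  shows "\<phi> \<alpha> \<delta> = 0"
proof (rule ccontr)
  assume c: "\<phi> \<alpha> \<delta> \<noteq> 0"
  have \<alpha>R: "\<alpha> \<in> R" using \<alpha> by (simp add: nonisotropic_iff)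
  let ?\<beta> = "\<lambda>n::int. \<lambda>h. \<alpha> h + of_int n * \<delta> h"
  \<comment> \<open>A non-zero Cartan integer bounds the norm of \<open>\<alpha> + n * \<delta>\<close> by \<open>2 * cmod (\<phi> \<alpha> \<delta>)\<close>; \<open>B\<close> is the
    resulting bound on \<open>n\<close>.\<close>
  define B where "B = (2 * cmod (\<phi> \<alpha> \<delta>) + cmod (\<phi> \<alpha> \<alpha>)) / (2 * cmod (\<phi> \<alpha> \<delta>))"
  have bound: "\<bar>real_of_int n\<bar> \<le> B" if root: "?\<beta> n \<in> R" for n
  proof -
    let ?q = "\<phi> (?\<beta> n) (?\<beta> n)"
    have q: "?q = \<phi> \<alpha> \<alpha> + 2 * of_int n * \<phi> \<alpha> \<delta>"
      using \<alpha>R \<delta> by (simp add: dual_form_add_mult_left dual_form_add_mult_right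
          dual_form_sym[of \<delta> \<alpha>] algebra_simps)
    have "cmod ?q \<le> 2 * cmod (\<phi> \<alpha> \<delta>)"
    proof (cases "?q = 0")
      case False
      then obtain k :: int where k: "2 * \<phi> \<delta> (?\<beta> n) = of_int k * ?q"
        using cartan_integer[OF _ \<delta>(1), of "?\<beta> n"] root by (auto simp: nonisotropic_iff)
      have "\<phi> \<delta> (?\<beta> n) = \<phi> \<alpha> \<delta>"
        using \<alpha>R \<delta> by (simp add: dual_form_add_mult_right dual_form_sym[of \<delta> \<alpha>])
      with k have k': "2 * \<phi> \<alpha> \<delta> = of_int k * ?q" by simp
      with c have "1 \<le> \<bar>real_of_int k\<bar>" by (cases "k = 0") auto
      then have "cmod ?q \<le> \<bar>real_of_int k\<bar> * cmod ?q"
        by (simp add: mult_le_cancel_right1)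
      also have "\<dots> = cmod (2 * \<phi> \<alpha> \<delta>)"
        by (simp only: k' norm_mult norm_of_int)
      finally show ?thesis by (simp add: norm_mult)
    qed simp
    moreover have "cmod (2 * of_int n * \<phi> \<alpha> \<delta>) \<le> cmod ?q + cmod (\<phi> \<alpha> \<alpha>)"
      using norm_triangle_ineq4[of ?q "\<phi> \<alpha> \<alpha>"] q by simp
    ultimately have "2 * \<bar>real_of_int n\<bar> * cmod (\<phi> \<alpha> \<delta>) \<le> 2 * cmod (\<phi> \<alpha> \<delta>) + cmod (\<phi> \<alpha> \<alpha>)"
      by (simp add: norm_mult)
    with c show ?thesis by (simp add: B_def field_simps)
  qed
  obtain M :: nat where M: "B < real M" using reals_Archimedean2 by blast
  have trivial: "x = 0" if "x \<in> E (?\<beta> n)" "int M \<le> \<bar>n\<bar>" for n x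
  proof (rule ccontr)
    assume "x \<noteq> 0"
    with that(1) have "?\<beta> n \<in> R"
      using dual_space_add_mult[OF roots_dual_space[OF \<alpha>R] roots_dual_space[OF \<delta>(1)]]
      by (intro rootI)
    from bound[OF this] M that(2) show False by linarith
  qed
  obtain x where x: "x \<in> E \<alpha>" "x \<noteq> 0" using nonzero_root_vector[OF \<alpha>R] .
  obtain e where e: "e \<in> E \<delta>" "e \<noteq> 0" using nonzero_root_vector[OF \<delta>(1)] .
  obtain f where f: "f \<in> E (\<lambda>h. - \<delta> h)" "form e f = 1" using opposite_root_vector[OF \<delta>(1) e] .
  have "(bracket e ^^ M) x = 0"
    using trivial[of "(bracket e ^^ M) x" "int M"] iterated_bracket_root_space[OF e(1) x(1), of M]
    by simp
  then obtain m where m: "m < M" "(bracket e ^^ m) x \<noteq> 0" "bracket e ((bracket e ^^ m) x) = 0"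
    using last_nonzero_iterate[OF x(2)] by metis
  have y: "(bracket e ^^ m) x \<in> E (\<lambda>h. \<alpha> h + of_nat m * \<delta> h)"
    by (rule iterated_bracket_root_space[OF e(1) x(1)])
  \<comment> \<open>Since \<open>m < M\<close>, lowering \<open>2 * M\<close> times leads from \<open>\<alpha> + m * \<delta>\<close> beyond \<open>\<alpha> - M * \<delta>\<close>.\<close>
  have "(bracket f ^^ (2 * M)) ((bracket e ^^ m) x) = 0"
  proof (rule trivial)
    show "(bracket f ^^ (2 * M)) ((bracket e ^^ m) x) \<in> E (?\<beta> (int m - 2 * int M))"
      using iterated_bracket_root_space[OF f(1) y, of "2 * M"] by (simp add: algebra_simps)
    show "int M \<le> \<bar>int m - 2 * int M\<bar>" using m(1) by linarith
  qed
  from highest_weight[OF \<delta>(1) e(1) f y m(2,3) this] \<delta>(2)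
  have "\<alpha> (t \<delta>) + of_nat m * \<delta> (t \<delta>) = 0" by (simp del: distrib_left_numeral)
  with c \<delta> \<alpha>R show False by (simp add: dual_form_eval)
qed

section \<open>The core\<close>

lemma root_space_core: "\<alpha> \<in> R' \<Longrightarrow> E \<alpha> \<subseteq> Core"
  unfolding core_def by (rule order_trans[OF _ hull_subset]) auto

lemma core_subalgebra: "lie_subalgebra scale bracket Core"
  unfolding core_def by (rule lie_subalgebra_hull)

lemma subspace_core: "subspace Core"
  using core_subalgebra by (simp add: lie_subalgebra_def)

text \<open>
  Adding an isotropic root to a non-isotropic root \<open>\<alpha>\<close> does not change its norm, by orthogonality.
  So a vector whose root is isotropic maps the generators of the core into root spaces of non-isotropic
  roots.
\<close>

lemma bracket_root_vector_generator:
  assumes \<beta>: "\<beta> \<in> R" "x \<in> E \<beta>" and \<alpha>: "\<alpha> \<in> R'" "y \<in> E \<alpha>"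
  shows "bracket x y \<in> Core"
proof (cases "\<phi> \<beta> \<beta> = 0")
  case True
  have \<alpha>R: "\<alpha> \<in> R" using \<alpha> by (simp add: nonisotropic_iff)
  let ?\<gamma> = "\<lambda>h. \<alpha> h + 1 * \<beta> h"
  have xy: "bracket x y \<in> E ?\<gamma>"
    by (rule bracket_root_spaces[OF \<beta>(2) \<alpha>(2)]) simp
  show ?thesis
  proof (cases "bracket x y = 0")
    case False
    have "?\<gamma> \<in> dual_space scale H"
      by (intro dual_space_add_mult roots_dual_space \<alpha>R \<beta>(1))
    with xy False have "?\<gamma> \<in> R" by (intro rootI)
    moreover have "\<phi> ?\<gamma> ?\<gamma> = \<phi> \<alpha> \<alpha>"
      using isotropic_orthogonal_nonisotropic[OF \<alpha>(1) \<beta>(1) True] True \<alpha>R \<beta>(1)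
      by (simp only: dual_form_add_mult_left dual_form_add_mult_right dual_form_sym[of \<beta> \<alpha>]) simp
    ultimately have "?\<gamma> \<in> R'" using \<alpha>(1) by (simp only: nonisotropic_iff) simp
    with xy root_space_core show ?thesis by blast
  qed (simp add: subspace_0[OF subspace_core])
next
  case False
  with \<beta> \<alpha> have "x \<in> Core" "y \<in> Core"
    using root_space_core by (auto simp: nonisotropic_iff)
  with core_subalgebra show ?thesis by (simp add: lie_subalgebra_def)
qed

lemma core_ideal:
  assumes "y \<in> Core"
  shows "bracket x y \<in> Core"
proof (induction x rule: root_vector_induct)
  case (root \<beta> x)
  let ?S = "{y \<in> Core. bracket x y \<in> Core}"
  have "subspace ?S"
    using subspace_core by (auto simp: subspace_def bracket_add_right bracket_scale_right)
  moreover have "bracket y z \<in> ?S" if "y \<in> ?S" "z \<in> ?S" for y z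
    using that core_subalgebra subspace_core
    by (auto simp: lie_subalgebra_def bracket_derivation[of x y z] intro!: subspace_add)
  ultimately have "lie_subalgebra scale bracket ?S"
    by (auto simp: lie_subalgebra_def)
  then have "Core \<subseteq> ?S"
    using bracket_root_vector_generator[OF root] root_space_core
    by (subst core_def, intro hull_minimal) auto
  with assms show ?case by auto
qed (auto simp: bracket_add_left bracket_scale_left
    intro: subspace_0[OF subspace_core] subspace_add[OF subspace_core] subspace_scale[OF subspace_core])

lemma centralizes_core:
  assumes "\<And>\<alpha> y. \<alpha> \<in> R' \<Longrightarrow> y \<in> E \<alpha> \<Longrightarrow> bracket x y = 0"
  shows "x \<in> center bracket Core"
proof -
  have "x \<in> centralizer bracket (\<Union>\<alpha>\<in>R'. E \<alpha>)"
    using assms by (auto simp: centralizer_def)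
  then have "x \<in> centralizer bracket Core"
    by (simp add: core_def centralizer_hull)
  with tame show ?thesis by (auto simp: center_def)
qed

text \<open>
  Let \<open>V\<close> be the sum of the \<open>t \<alpha>\<close> with \<open>\<alpha>\<close> non-isotropic and of all root spaces of non-zero roots. It
  contains the generators of the core and is invariant under them: a bracket with a generator
  returns to \<open>H\<close> only through a non-isotropic root. So it contains the core. The intersection
  of \<open>V\<close> with \<open>H\<close> is read off from the form, because the root spaces of non-zero roots are orthogonal
  to \<open>H\<close>.
\<close>

lemma H_core_span:
  assumes "h \<in> H" "h \<in> Core"
  shows "h \<in> span (t ` R')"
proof -
  let ?Z = "\<Union>\<beta>\<in>{\<beta> \<in> R. \<exists>h\<in>H. \<beta> h \<noteq> 0}. E \<beta>"
  let ?V = "span (t ` R' \<union> ?Z)"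
  have nonzero: "\<exists>h\<in>H. \<alpha> h \<noteq> 0" if "\<alpha> \<in> R'" for \<alpha>
    using that by (auto simp: nonisotropic_iff dual_form_eval dual_vector(1) intro!: bexI[of _ "t \<alpha>"])
  then have gen: "E \<alpha> \<subseteq> ?V" if "\<alpha> \<in> R'" for \<alpha>
    using that by (auto simp: nonisotropic_iff intro!: span_base)
  have inv: "bracket x v \<in> ?V" if \<alpha>: "\<alpha> \<in> R'" and x: "x \<in> E \<alpha>" and "v \<in> ?V" for \<alpha> x v
    using \<open>v \<in> ?V\<close>
  proof (induction v rule: span_induct)
    case base
    show ?case
      by (auto simp: subspace_def bracket_add_right bracket_scale_right
          intro: span_zero span_add span_scale)
  next
    case (step v)
    then consider (t) \<beta> where "\<beta> \<in> R'" "v = t \<beta>"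
      | (root) \<beta> where "\<beta> \<in> R" "v \<in> E \<beta>" by auto
    then show ?case
    proof cases
      case t
      then have "bracket x v = scale (- \<alpha> v) x"
        using bracket_skew[of x v] bracket_H_root_space[OF _ x, of v] dual_vector(1)
        by (simp add: nonisotropic_iff)
      moreover have "x \<in> ?V" using gen[OF \<alpha>] x by blast
      ultimately show ?thesis by (simp only: span_scale)
    next
      case root
      have \<alpha>R: "\<alpha> \<in> R" using \<alpha> by (simp add: nonisotropic_iff)
      let ?\<gamma> = "\<lambda>h. \<alpha> h + 1 * \<beta> h"
      have xv: "bracket x v \<in> E ?\<gamma>"
        by (rule bracket_root_spaces[OF x root(2)]) simp
      show ?thesis
      proof (cases "\<exists>h\<in>H. ?\<gamma> h \<noteq> 0")
        case True
        have "?\<gamma> \<in> dual_space scale H"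
          by (intro dual_space_add_mult roots_dual_space \<alpha>R root(1))
        with xv True have "bracket x v \<noteq> 0 \<Longrightarrow> bracket x v \<in> ?Z"
          using rootI[of ?\<gamma> "bracket x v"] by blast
        then show ?thesis
          by (cases "bracket x v = 0") (auto intro: span_base span_zero)
      next
        case False
        then have "E \<beta> = E (\<lambda>h. - \<alpha> h)"
          by (intro root_space_cong) (simp add: eq_neg_iff_add_eq_0 add.commute)
        with root(2) have "bracket x v = scale (form x v) (t \<alpha>)"
          by (intro bracket_opposite[OF \<alpha>R x]) simp
        moreover have "t \<alpha> \<in> ?V" using \<alpha> by (intro span_base) blast
        ultimately show ?thesis by (simp only: span_scale)
      qed
    qed
  qed
  have "Core \<subseteq> ?V"
    unfolding core_def using gen inv by (intro hull_subset_invariant_subspace) auto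
  with assms(2) obtain s z where s: "s \<in> span (t ` R')" and z: "z \<in> span ?Z" and h: "h = s + z"
    by (auto simp: span_Un)
  have "span (t ` R') \<subseteq> H"
    using dual_vector(1) by (intro span_minimal subspace_H) (auto simp: nonisotropic_iff)
  with s h assms(1) have zH: "z \<in> H"
    using subspace_diff[OF subspace_H, of h s] by auto
  have orth: "form k z = 0" if k: "k \<in> H" for k
    using z
  proof (induction z rule: span_induct)
    case base
    show ?case by (auto simp: subspace_def form_add_right form_scale_right)
  next
    case (step z)
    then obtain \<beta> h where "z \<in> E \<beta>" "h \<in> H" "\<beta> h \<noteq> 0" by auto
    with k show ?case
      using form_root_spaces[of k "\<lambda>h. 0" z \<beta> h] root_space_zero by simp
  qed
  from H_eq_zeroI[OF zH orth] s h show ?thesis by simp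
qed

end

section \<open>Automorphisms of finite order\<close>

locale finite_order_automorphism = extended_affine_lie_algebra scale bracket form H
  for scale :: "complex \<Rightarrow> 'e::ab_group_add \<Rightarrow> 'e" and bracket :: "'e \<Rightarrow> 'e \<Rightarrow> 'e"
    and form :: "'e \<Rightarrow> 'e \<Rightarrow> complex" and H :: "'e set" +
  fixes \<tau> :: "'e \<Rightarrow> 'e" and \<epsilon> :: complex
  assumes automorphism: "lie_automorphism scale bracket \<tau>"
    and finite_order: "\<exists>n>0. \<tau> ^^ n = id"
    and sign: "\<epsilon> \<in> {1, - 1}"
begin

lemma tau_add: "\<tau> (x + y) = \<tau> x + \<tau> y"
  and tau_scale: "\<tau> (scale c x) = scale c (\<tau> x)"
  and tau_bracket: "\<tau> (bracket x y) = bracket (\<tau> x) (\<tau> y)"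
  and tau_bij: "bij \<tau>"
  using automorphism by (auto simp: lie_automorphism_def Vector_Spaces.linear_iff)

lemma tau_zero [simp]: "\<tau> 0 = 0"
  using tau_scale[of 0 0] by simp

lemma tau_eq_iff: "\<tau> x = \<tau> y \<longleftrightarrow> x = y"
  using tau_bij by (meson bij_def inj_eq)

lemma sign_square [simp]: "\<epsilon> * \<epsilon> = 1" "\<epsilon> * (\<epsilon> * c) = c"
  using sign by auto

lemma sign_nonzero [simp]: "\<epsilon> \<noteq> 0"
  using sign by auto

text \<open>
  Applying \<open>\<tau> \<circ> \<tau>\<close> repeatedly to \<open>x\<close> adds \<open>z\<close> each time, so \<open>x\<close> recurs only if \<open>z\<close> is zero.
\<close>

lemma no_displacement:
  assumes x: "\<tau> (\<tau> x) = x + z" and z: "\<tau> (\<tau> z) = z"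
  shows "z = 0"
proof -
  obtain N where N: "N > 0" "\<tau> ^^ N = id"
    using finite_order by blast
  have step: "(\<tau> ^^ (2 * n)) x = x + scale (of_nat n) z" for n
  proof (induction n)
    case (Suc n)
    have "(\<tau> ^^ (2 * Suc n)) x = \<tau> (\<tau> ((\<tau> ^^ (2 * n)) x))" by simp
    also have "\<dots> = x + scale (of_nat (Suc n)) z"
      by (simp only: Suc.IH) (simp add: tau_add tau_scale x z scale_left_distrib)
    finally show ?case .
  qed simp
  have "\<tau> ^^ (2 * N) = id"
    using N(2) by (simp add: mult_2 funpow_add)
  with step[of N] N(1) show ?thesis by simp
qed

lemma sign_root: "\<alpha> \<in> R \<Longrightarrow> (\<lambda>h. \<epsilon> * \<alpha> h) \<in> R"
  using sign minus_root[of \<alpha>] by auto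

lemma sign_dual_vector: "\<alpha> \<in> R \<Longrightarrow> t (\<lambda>h. \<epsilon> * \<alpha> h) = scale \<epsilon> (t \<alpha>)"
  using sign dual_vector_minus[of \<alpha>] by auto

lemma scaled_dual_vector:
  assumes \<alpha>: "\<alpha> \<in> R" and xy: "x \<in> E \<alpha>" "y \<in> E (\<lambda>h. - \<alpha> h)"
    and \<tau>: "\<tau> x \<in> E (\<lambda>h. \<epsilon> * \<alpha> h)" "\<tau> y \<in> E (\<lambda>h. \<epsilon> * - \<alpha> h)"
  shows "scale (form x y) (\<tau> (t \<alpha>)) = scale (\<epsilon> * form (\<tau> x) (\<tau> y)) (t \<alpha>)"
proof -
  have "scale (form x y) (\<tau> (t \<alpha>)) = bracket (\<tau> x) (\<tau> y)"
    using bracket_opposite[OF \<alpha> xy] by (simp flip: tau_scale tau_bracket)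
  also have "\<dots> = scale (form (\<tau> x) (\<tau> y)) (t (\<lambda>h. \<epsilon> * \<alpha> h))"
    using \<tau> by (intro bracket_opposite sign_root[OF \<alpha>]) simp_all
  finally show ?thesis
    by (simp add: sign_dual_vector[OF \<alpha>] mult.commute)
qed

text \<open>
  By the preceding lemma \<open>\<tau>\<close> maps \<open>t \<alpha>\<close> to a multiple of itself. The factor is \<open>\<epsilon>\<close> because \<open>t \<alpha>\<close> acts
  on the root space of \<open>\<alpha>\<close> by the non-zero scalar \<open>\<phi> \<alpha> \<alpha>\<close>, and \<open>\<tau> (t \<alpha>)\<close> must act by the same scalar
  on the image of that root space.
\<close>

lemma tau_dual_vector:
  assumes nonisotropic: "\<And>\<alpha>. \<alpha> \<in> R' \<Longrightarrow> \<tau> ` E \<alpha> = E (\<lambda>h. \<epsilon> * \<alpha> h)" and \<alpha>: "\<alpha> \<in> R'"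
  shows "\<tau> (t \<alpha>) = scale \<epsilon> (t \<alpha>)"
proof -
  have \<alpha>R: "\<alpha> \<in> R" and norm: "\<alpha> (t \<alpha>) \<noteq> 0"
    using \<alpha> by (auto simp: nonisotropic_iff dual_form_eval)
  obtain x where x: "x \<in> E \<alpha>" "x \<noteq> 0" using nonzero_root_vector[OF \<alpha>R] .
  obtain y where y: "y \<in> E (\<lambda>h. - \<alpha> h)" "form x y = 1" using opposite_root_vector[OF \<alpha>R x] .
  have \<tau>x: "\<tau> x \<in> E (\<lambda>h. \<epsilon> * \<alpha> h)" and \<tau>y: "\<tau> y \<in> E (\<lambda>h. \<epsilon> * - \<alpha> h)"
    using nonisotropic[OF \<alpha>] nonisotropic[OF minus_nonisotropic[OF \<alpha>]] x(1) y(1) by blast+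
  define c where "c = form (\<tau> x) (\<tau> y)"
  have \<tau>t: "\<tau> (t \<alpha>) = scale (\<epsilon> * c) (t \<alpha>)"
    using scaled_dual_vector[OF \<alpha>R x(1) y(1) \<tau>x \<tau>y] y(2) by (simp add: c_def)
  have "scale (\<alpha> (t \<alpha>)) (\<tau> x) = bracket (\<tau> (t \<alpha>)) (\<tau> x)"
    using bracket_H_root_space[OF dual_vector(1)[OF \<alpha>R] x(1)] by (simp flip: tau_scale tau_bracket)
  also have "\<dots> = scale (c * \<alpha> (t \<alpha>)) (\<tau> x)"
    using bracket_H_root_space[OF dual_vector(1)[OF \<alpha>R] \<tau>x]
    by (simp add: \<tau>t bracket_scale_left mult.assoc mult.left_commute[of c])
  finally have "\<alpha> (t \<alpha>) = c * \<alpha> (t \<alpha>)"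
    using x(2) tau_eq_iff[of x 0] by simp
  with norm \<tau>t show ?thesis by simp
qed

lemma tau_H_core:
  assumes nonisotropic: "\<And>\<alpha>. \<alpha> \<in> R' \<Longrightarrow> \<tau> ` E \<alpha> = E (\<lambda>h. \<epsilon> * \<alpha> h)"
    and h: "h \<in> H" "h \<in> Core"
  shows "\<tau> h = scale \<epsilon> h"
  using H_core_span[OF h]
proof (induction h rule: span_induct)
  case base
  show ?case
    by (auto simp: subspace_def tau_add tau_scale scale_right_distrib mult.commute)
next
  case (step h)
  then show ?case using tau_dual_vector[OF nonisotropic] by blast
qed

text \<open>
  Both terms of the difference act on the root space of \<open>\<epsilon> * \<alpha>\<close> by the scalar \<open>\<alpha> h\<close>.
\<close>

lemma tau_H_difference_annihilates:
  assumes "\<tau> ` E \<alpha> = E (\<lambda>h. \<epsilon> * \<alpha> h)" and x: "x \<in> E \<alpha>" and h: "h \<in> H"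
  shows "bracket (\<tau> h - scale \<epsilon> h) (\<tau> x) = 0"
proof -
  have "\<tau> x \<in> E (\<lambda>h. \<epsilon> * \<alpha> h)" using assms by blast
  then have "bracket (scale \<epsilon> h) (\<tau> x) = scale (\<alpha> h) (\<tau> x)"
    using h by (simp add: bracket_scale_left bracket_H_root_space)
  moreover have "bracket (\<tau> h) (\<tau> x) = scale (\<alpha> h) (\<tau> x)"
    using bracket_H_root_space[OF h x] by (simp flip: tau_bracket tau_scale)
  ultimately show ?thesis by (simp add: bracket_diff_left)
qed

lemma tau_H_modulo_center:
  assumes nonisotropic: "\<And>\<alpha>. \<alpha> \<in> R' \<Longrightarrow> \<tau> ` E \<alpha> = E (\<lambda>h. \<epsilon> * \<alpha> h)" and h: "h \<in> H"
  shows "\<tau> h - scale \<epsilon> h \<in> center bracket Core"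
proof (rule centralizes_core)
  fix \<alpha> y assume \<alpha>: "\<alpha> \<in> R'" and y: "y \<in> E \<alpha>"
  let ?\<alpha> = "\<lambda>h. \<epsilon> * \<alpha> h"
  have \<alpha>': "?\<alpha> \<in> R'"
    using sign \<alpha> minus_nonisotropic[OF \<alpha>] by auto
  from nonisotropic[OF this] y obtain x where "x \<in> E ?\<alpha>" "y = \<tau> x"
    by auto
  with tau_H_difference_annihilates[OF nonisotropic[OF \<alpha>'] _ h]
  show "bracket (\<tau> h - scale \<epsilon> h) y = 0" by simp
qed

text \<open>
  Since opposite root spaces of non-isotropic roots are lines, \<open>\<tau>\<close> interchanges \<open>x\<close> and \<open>y\<close> up to
  factors \<open>c\<close> and \<open>d\<close>. Applying \<open>\<tau>\<close> to \<open>bracket x y = t \<alpha>\<close> gives \<open>c * d = 1\<close>.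
\<close>

lemma tau_square_generator:
  assumes nonisotropic: "\<And>\<alpha>. \<alpha> \<in> R' \<Longrightarrow> \<tau> ` E \<alpha> = E (\<lambda>h. \<epsilon> * \<alpha> h)" and \<epsilon>: "\<epsilon> = - 1"
    and \<alpha>: "\<alpha> \<in> R'" and x: "x \<in> E \<alpha>"
  shows "\<tau> (\<tau> x) = x"
proof (cases "x = 0")
  case False
  have \<alpha>R: "\<alpha> \<in> R" and norm: "\<alpha> (t \<alpha>) \<noteq> 0"
    using \<alpha> by (auto simp: nonisotropic_iff dual_form_eval)
  obtain y where y: "y \<in> E (\<lambda>h. - \<alpha> h)" "form x y = 1"
    using opposite_root_vector[OF \<alpha>R x False] .
  have \<tau>x: "\<tau> x \<in> E (\<lambda>h. - \<alpha> h)" and \<tau>y: "\<tau> y \<in> E \<alpha>"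
    using nonisotropic[OF \<alpha>] nonisotropic[OF minus_nonisotropic[OF \<alpha>]] x y(1) \<epsilon> by auto
  define c where "c = form x (\<tau> x)"
  define d where "d = form y (\<tau> y)"
  have c: "\<tau> x = scale c y"
    unfolding c_def by (rule nonisotropic_root_space_line[OF \<alpha> x y \<tau>x])
  have d: "\<tau> y = scale d x"
    unfolding d_def using x y \<tau>y form_symmetric[of x y]
    by (intro nonisotropic_root_space_line[OF minus_nonisotropic[OF \<alpha>] y(1)]) simp_all
  have "scale (- 1) (t \<alpha>) = scale (- form (\<tau> x) (\<tau> y)) (t \<alpha>)"
    using scaled_dual_vector[OF \<alpha>R x y(1)] tau_dual_vector[OF nonisotropic \<alpha>] \<tau>x \<tau>y y(2) \<epsilon> by simp
  moreover have "t \<alpha> \<noteq> 0"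
    using norm dual_vector(2)[OF \<alpha>R dual_vector(1)[OF \<alpha>R]] by auto
  ultimately have "form (\<tau> x) (\<tau> y) = 1"
    using scale_cancel_right[of "- 1" "t \<alpha>" "- form (\<tau> x) (\<tau> y)"] by simp
  then have "c * d = 1"
    using y(2) form_symmetric[of x y] by (simp add: c d form_scale_left form_scale_right mult.commute)
  then show ?thesis by (simp add: c d tau_scale)
qed simp

text \<open>
  On the core the square of \<open>\<tau>\<close> is the identity because it is so on generators. As the core is an ideal, the
  displacement \<open>\<tau> (\<tau> x) - x\<close> of any \<open>x\<close> centralizes the core. By tameness it lies in the core, so
  \<open>\<tau> \<circ> \<tau>\<close> fixes it, and finite order forces it to vanish.
\<close>

lemma tau_involution:
  assumes nonisotropic: "\<And>\<alpha>. \<alpha> \<in> R' \<Longrightarrow> \<tau> ` E \<alpha> = E (\<lambda>h. \<epsilon> * \<alpha> h)" and \<epsilon>: "\<epsilon> = - 1"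
  shows "\<tau> \<circ> \<tau> = id"
proof -
  have "lie_subalgebra scale bracket {x. \<tau> (\<tau> x) = x}"
    by (auto simp: lie_subalgebra_def subspace_def tau_add tau_scale tau_bracket)
  then have "Core \<subseteq> {x. \<tau> (\<tau> x) = x}"
    using tau_square_generator[OF nonisotropic \<epsilon>] by (subst core_def, intro hull_minimal) auto
  then have core: "\<tau> (\<tau> y) = y" if "y \<in> Core" for y
    using that by auto
  have "\<tau> (\<tau> x) = x" for x
  proof -
    let ?z = "\<tau> (\<tau> x) - x"
    have "?z \<in> center bracket Core"
    proof (rule centralizes_core)
      fix \<alpha> y assume "\<alpha> \<in> R'" "y \<in> E \<alpha>"
      then have y: "y \<in> Core" using root_space_core by blast
      have "bracket (\<tau> (\<tau> x)) y = \<tau> (\<tau> (bracket x y))"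
        using core[OF y] by (simp add: tau_bracket)
      also have "\<dots> = bracket x y"
        by (intro core core_ideal y)
      finally show "bracket ?z y = 0" by (simp add: bracket_diff_left)
    qed
    then have "\<tau> (\<tau> ?z) = ?z"
      by (intro core) (simp add: center_def)
    then have "?z = 0"
      by (intro no_displacement[of x]) simp_all
    then show ?thesis by simp
  qed
  then show ?thesis by (simp add: fun_eq_iff)
qed

text \<open>
  The zero root space is \<open>H\<close>, so \<open>z = \<tau> h - scale \<epsilon> h\<close> lies in \<open>H\<close>. By tameness it also lies in the
  core, and on the intersection \<open>\<tau>\<close> is already known to be \<open>\<epsilon>\<close>. So \<open>\<tau> \<circ> \<tau>\<close>
  maps \<open>h\<close> to \<open>h + 2 * \<epsilon> * z\<close> and fixes \<open>z\<close>.
\<close>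

lemma tau_H:
  assumes all: "\<And>\<alpha>. \<alpha> \<in> R \<Longrightarrow> \<tau> ` E \<alpha> = E (\<lambda>h. \<epsilon> * \<alpha> h)" and h: "h \<in> H"
  shows "\<tau> h = scale \<epsilon> h"
proof -
  have nonisotropic: "\<And>\<alpha>. \<alpha> \<in> R' \<Longrightarrow> \<tau> ` E \<alpha> = E (\<lambda>h. \<epsilon> * \<alpha> h)"
    using all by (simp add: nonisotropic_iff)
  define z where "z = \<tau> h - scale \<epsilon> h"
  have "\<tau> ` H = H"
    using all[OF zero_root] root_space_zero by simp
  with h have zH: "z \<in> H"
    unfolding z_def by (intro subspace_diff[OF subspace_H] subspace_scale[OF subspace_H]) blast+
  have "z \<in> center bracket Core"
    unfolding z_def by (rule tau_H_modulo_center[OF nonisotropic h])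
  then have "z \<in> Core"
    by (simp add: center_def)
  then have \<tau>z: "\<tau> z = scale \<epsilon> z"
    by (intro tau_H_core nonisotropic zH)
  have \<tau>h: "\<tau> h = z + scale \<epsilon> h" by (simp add: z_def)
  have "\<tau> (\<tau> h) = scale \<epsilon> z + scale \<epsilon> (z + scale \<epsilon> h)"
    by (simp only: \<tau>h \<tau>z tau_add tau_scale)
  also have "\<dots> = h + (scale \<epsilon> z + scale \<epsilon> z)"
    by (simp add: scale_right_distrib)
  also have "scale \<epsilon> z + scale \<epsilon> z = scale (2 * \<epsilon>) z"
    by (simp only: mult_2 scale_left_distrib)
  finally have "\<tau> (\<tau> h) = h + scale (2 * \<epsilon>) z" .
  moreover have "\<tau> (\<tau> z) = z"
    by (simp add: \<tau>z tau_scale)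
  ultimately have "scale (2 * \<epsilon>) z = 0"
    by (intro no_displacement[of h]) (simp_all add: tau_scale)
  then show ?thesis by (simp add: \<tau>h)
qed

lemma tau_root_space:
  assumes H: "\<And>h. h \<in> H \<Longrightarrow> \<tau> h = scale \<epsilon> h"
  shows "\<tau> ` E \<alpha> = E (\<lambda>h. \<epsilon> * \<alpha> h)"
proof -
  have "\<tau> x \<in> E (\<lambda>h. \<epsilon> * \<alpha> h) \<longleftrightarrow> x \<in> E \<alpha>" for x
  proof -
    have "bracket h (\<tau> x) = scale (\<epsilon> * \<alpha> h) (\<tau> x) \<longleftrightarrow> bracket h x = scale (\<alpha> h) x" if "h \<in> H" for h
    proof -
      have "bracket h (\<tau> x) = scale \<epsilon> (\<tau> (bracket h x))"
        by (simp add: tau_bracket H[OF that] bracket_scale_left)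
      moreover have "scale (\<epsilon> * \<alpha> h) (\<tau> x) = scale \<epsilon> (\<tau> (scale (\<alpha> h) x))"
        by (simp add: tau_scale)
      ultimately show ?thesis by (simp only: scale_cancel_left sign_nonzero tau_eq_iff simp_thms)
    qed
    then show ?thesis by (auto simp: root_space_def)
  qed
  then have "E \<alpha> = \<tau> -` E (\<lambda>h. \<epsilon> * \<alpha> h)" by auto
  then show ?thesis using tau_bij by (simp add: bij_is_surj surj_image_vimage_eq)
qed

text \<open>
  Only opposite root spaces matter. For a root that does not vanish on \<open>H\<close>, comparing \<open>\<tau> (bracket x y)\<close>
  with \<open>bracket (\<tau> x) (\<tau> y)\<close> shows that the form is preserved; the zero root space is \<open>H\<close>, where
  \<open>\<tau>\<close> is a sign.
\<close>

lemma tau_form_root_spaces: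
  assumes all: "\<And>\<alpha>. \<alpha> \<in> R \<Longrightarrow> \<tau> ` E \<alpha> = E (\<lambda>h. \<epsilon> * \<alpha> h)"
    and x: "\<alpha> \<in> R" "x \<in> E \<alpha>" and y: "\<beta> \<in> R" "y \<in> E \<beta>"
  shows "form (\<tau> x) (\<tau> y) = form x y"
proof (cases "\<exists>h\<in>H. \<alpha> h + \<beta> h \<noteq> 0")
  case True
  then obtain h where h: "h \<in> H" "\<alpha> h + \<beta> h \<noteq> 0" by blast
  have \<tau>x: "\<tau> x \<in> E (\<lambda>h. \<epsilon> * \<alpha> h)" and \<tau>y: "\<tau> y \<in> E (\<lambda>h. \<epsilon> * \<beta> h)"
    using all x y by blast+
  have "form (\<tau> x) (\<tau> y) = 0"
    using h(2) by (intro form_root_spaces[OF \<tau>x \<tau>y h(1)]) (simp flip: distrib_left)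
  with form_root_spaces[OF x(2) y(2) h] show ?thesis by simp
next
  case False
  then have "\<beta> h = - \<alpha> h" if "h \<in> H" for h
    using that by (simp add: eq_neg_iff_add_eq_0 add.commute)
  then have E\<beta>: "E \<beta> = E (\<lambda>h. - \<alpha> h)" "E (\<lambda>h. \<epsilon> * \<beta> h) = E (\<lambda>h. \<epsilon> * - \<alpha> h)"
    by (auto intro!: root_space_cong)
  show ?thesis
  proof (cases "\<exists>h\<in>H. \<alpha> h \<noteq> 0")
    case True
    then have t: "t \<alpha> \<noteq> 0"
      using dual_vector(2)[OF x(1)] by force
    have "\<tau> (t \<alpha>) = scale \<epsilon> (t \<alpha>)"
      using tau_H[OF all] dual_vector(1)[OF x(1)] by blast
    moreover have "scale (form x y) (\<tau> (t \<alpha>)) = scale (\<epsilon> * form (\<tau> x) (\<tau> y)) (t \<alpha>)"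
      using all x y E\<beta> by (intro scaled_dual_vector) blast+
    ultimately show ?thesis using t by (simp add: mult.commute)
  next
    case False
    then have "x \<in> H" "y \<in> H"
      using x(2) y(2) root_space_eq_H[of \<alpha>] root_space_eq_H[of "\<lambda>h. - \<alpha> h"] E\<beta> by auto
    then show ?thesis
      using tau_H[OF all] by (simp add: form_scale_left form_scale_right)
  qed
qed

lemma tau_form:
  assumes all: "\<And>\<alpha>. \<alpha> \<in> R \<Longrightarrow> \<tau> ` E \<alpha> = E (\<lambda>h. \<epsilon> * \<alpha> h)"
  shows "form (\<tau> x) (\<tau> y) = form x y"
proof (induction x rule: root_vector_induct)
  case (root \<alpha> x)
  show ?case
    by (induction y rule: root_vector_induct)
      (auto simp: tau_form_root_spaces[OF all root] tau_add tau_scale form_add_right form_scale_right)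
qed (auto simp: tau_add tau_scale form_add_left form_scale_left)

end

theorem lemma3p1p2:
  fixes scale :: "complex \<Rightarrow> 'e::ab_group_add \<Rightarrow> 'e"
    and bracket :: "'e \<Rightarrow> 'e \<Rightarrow> 'e"
    and form :: "'e \<Rightarrow> 'e \<Rightarrow> complex"
    and H :: "'e set"
    and \<tau> :: "'e \<Rightarrow> 'e"
    and \<epsilon> :: complex
  assumes "extended_affine_lie_algebra scale bracket form H"
    and "lie_automorphism scale bracket \<tau>"
    and "\<exists>n>0. \<tau> ^^ n = id"
    and "\<epsilon> \<in> {1, - 1}"
  shows "((\<forall>\<alpha>\<in>nonisotropic_roots scale bracket form H.
             \<tau> ` root_space scale bracket H \<alpha> = root_space scale bracket H (\<lambda>h. \<epsilon> * \<alpha> h)) \<longrightarrow>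
           (\<forall>h\<in>H \<inter> core scale bracket form H. \<tau> h = scale \<epsilon> h) \<and>
           (\<epsilon> = - 1 \<longrightarrow> \<tau> \<circ> \<tau> = id) \<and>
           (\<forall>h\<in>H. \<tau> h - scale \<epsilon> h \<in> center bracket (core scale bracket form H)))
       \<and> ((\<forall>\<alpha>\<in>roots scale bracket H.
             \<tau> ` root_space scale bracket H \<alpha> = root_space scale bracket H (\<lambda>h. \<epsilon> * \<alpha> h)) \<longleftrightarrow>
           (\<forall>h\<in>H. \<tau> h = scale \<epsilon> h))
       \<and> ((\<forall>\<alpha>\<in>roots scale bracket H.
             \<tau> ` root_space scale bracket H \<alpha> = root_space scale bracket H (\<lambda>h. \<epsilon> * \<alpha> h)) \<longrightarrow>
           (\<forall>x y. form (\<tau> x) (\<tau> y) = form x y))"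
proof -
  interpret finite_order_automorphism scale bracket form H \<tau> \<epsilon>
    using assms by (intro finite_order_automorphism.intro finite_order_automorphism_axioms.intro)
  show ?thesis
  proof (intro conjI impI)
    assume "\<forall>\<alpha>\<in>R'. \<tau> ` E \<alpha> = E (\<lambda>h. \<epsilon> * \<alpha> h)"
    then have nonisotropic: "\<And>\<alpha>. \<alpha> \<in> R' \<Longrightarrow> \<tau> ` E \<alpha> = E (\<lambda>h. \<epsilon> * \<alpha> h)" by blast
    show "\<forall>h\<in>H \<inter> Core. \<tau> h = scale \<epsilon> h"
      by (intro ballI tau_H_core nonisotropic) blast+
    show "\<tau> \<circ> \<tau> = id" if "\<epsilon> = - 1"
      by (intro tau_involution nonisotropic that)
    show "\<forall>h\<in>H. \<tau> h - scale \<epsilon> h \<in> center bracket Core"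
      by (intro ballI tau_H_modulo_center nonisotropic)
  next
    show "(\<forall>\<alpha>\<in>R. \<tau> ` E \<alpha> = E (\<lambda>h. \<epsilon> * \<alpha> h)) \<longleftrightarrow> (\<forall>h\<in>H. \<tau> h = scale \<epsilon> h)"
    proof (intro iffI ballI)
      fix h assume "\<forall>\<alpha>\<in>R. \<tau> ` E \<alpha> = E (\<lambda>h. \<epsilon> * \<alpha> h)" and "h \<in> H"
      then show "\<tau> h = scale \<epsilon> h" by (intro tau_H) blast+
    next
      fix \<alpha> assume "\<forall>h\<in>H. \<tau> h = scale \<epsilon> h"
      then show "\<tau> ` E \<alpha> = E (\<lambda>h. \<epsilon> * \<alpha> h)" by (intro tau_root_space) blast
    qed
  next
    assume "\<forall>\<alpha>\<in>R. \<tau> ` E \<alpha> = E (\<lambda>h. \<epsilon> * \<alpha> h)"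
    then show "\<forall>x y. form (\<tau> x) (\<tau> y) = form x y"
      by (intro allI tau_form) blast
  qed
qed

end
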